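(* Let $N,t$ be positive integers with $t\mid N$, and let $T(N,t)$ be the regular Turán graph, i.e. the complete $t$-partite graph on $N$ vertices whose parts $P_1,\ldots,P_t$ all have size $N/t$. Every FAT coloring of $T(N,t)$ falls into one of the following two cases: (1) (balanced case) each part $P_g$ contains all colors, each occurring the same number of times in $P_g$; (2) (monochromatic case) each part $P_g$ contains exactly one color, and each color appears on exactly the same number of parts. As a consequence, $\chi^{\mathrm{FAT}}(T(N,t))=\max\{t,N/t\}$.
   Context: A complete $t$-partite graph has vertex set partitioned into independent sets (parts) with an edge between every two vertices in different parts. For $v\in V$ and $S\subseteq V$, let $e(v,S)$ denote the number of neighbors of $v$ in $S$. A vertex $k$-coloring is a function $c:V\to\{1,\ldots,k\}$ with coloring classes $V_i=c^{-1}(i)$. It is Fair and Tolerant (FAT) if there exists $\alpha\in[0,1]$ such that, with $\beta:=1-(k-1)\alpha$, for every vertex $v$ and every $i$ we have $e(v,V_i)=\alpha\deg v$ if $v\notin V_i$ and $e(v,V_i)=\beta\deg v$ if $v\in V_i$. The FAT chromatic number $\chi^{\mathrm{FAT}}(G)$ is the largest $k$ such that $G$ admits a FAT $k$-coloring.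
   Formalization: The two-case claim is for t ≥ 2, as it fails for t = 1 (no edges, so every coloring is FAT, e.g. N = 3 with colors 1, 1, 2); the formula for the FAT chromatic number covers all t. Every one of the k colors must be used, since otherwise the FAT chromatic number would be undefined. *)

theory Defs
  imports Complex_Main "Graph_Theory.Pair_Digraph" "HOL-Library.Disjoint_Sets"
begin

text \<open>
  A finite simple graph is a \<^locale>\<open>pair_graph\<close>: an edge \<open>{u, v}\<close> is represented by the two
  arcs \<open>(u, v)\<close> and \<open>(v, u)\<close>, so that \<^const>\<open>out_degree\<close> is the usual degree.
\<close>

definition complete_partite :: "'a pair_pre_digraph \<Rightarrow> nat \<Rightarrow> (nat \<Rightarrow> 'a set) \<Rightarrow> bool" where
  "complete_partite G t P \<longleftrightarrow>
     pair_graph G \<and>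
     (\<forall>g\<in>{1..t}. P g \<noteq> {}) \<and>
     disjoint_family_on P {1..t} \<and>
     pverts G = (\<Union>g\<in>{1..t}. P g) \<and>
     parcs G = {(u, v). \<exists>g\<in>{1..t}. \<exists>h\<in>{1..t}. g \<noteq> h \<and> u \<in> P g \<and> v \<in> P h}"

text \<open>\<open>regular_turan_graph G N t P\<close>: the graph \<open>G\<close> is (a copy of) \<open>T(N, t)\<close>, with parts
  \<open>P 1, \<dots>, P t\<close>. It is meant to be used for \<open>t dvd N\<close>, where \<open>N div t\<close> is exact.\<close>

definition regular_turan_graph ::
    "'a pair_pre_digraph \<Rightarrow> nat \<Rightarrow> nat \<Rightarrow> (nat \<Rightarrow> 'a set) \<Rightarrow> bool" where
  "regular_turan_graph G N t P \<longleftrightarrow>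
     complete_partite G t P \<and> card (pverts G) = N \<and> (\<forall>g\<in>{1..t}. card (P g) = N div t)"

lemma regular_turan_graph_exists:
  assumes "N \<ge> 1" "t \<ge> 1" "t dvd N"
  shows "\<exists>(G :: (nat \<times> nat) pair_pre_digraph) P. regular_turan_graph G N t P"
proof -
  let ?m = "N div t"
  let ?P = "\<lambda>g::nat. {g} \<times> {..<?m}"
  let ?G = "\<lparr>pverts = (\<Union>g\<in>{1..t}. ?P g),
     parcs = {(u, v). \<exists>g\<in>{1..t}. \<exists>h\<in>{1..t}. g \<noteq> h \<and> u \<in> ?P g \<and> v \<in> ?P h}\<rparr>"
  have V: "(\<Union>g\<in>{1..t}. ?P g) = {1..t} \<times> {..<?m}" by auto
  have m: "?m > 0" using assms by (auto elim!: dvdE)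
  have "finite (parcs ?G)"
    by (rule finite_subset[of _ "({1..t} \<times> {..<?m}) \<times> ({1..t} \<times> {..<?m})"]) auto
  hence "pair_graph ?G"
    by unfold_locales (auto simp: symmetric_def intro!: symI)
  hence "complete_partite ?G t ?P"
    using m by (auto simp: complete_partite_def disjoint_family_on_def)
  moreover have "card (pverts ?G) = N"
    using assms by (simp only: V pair_pre_digraph.simps card_cartesian_product) simp
  ultimately show ?thesis
    unfolding regular_turan_graph_def by (intro exI[of _ ?G] exI[of _ ?P]) simp
qed

definition nbrs_in :: "'a pair_pre_digraph \<Rightarrow> 'a \<Rightarrow> 'a set \<Rightarrow> nat" where
  "nbrs_in G v S = card {u \<in> S. (v, u) \<in> parcs G}"

definition color_class :: "'a pair_pre_digraph \<Rightarrow> ('a \<Rightarrow> nat) \<Rightarrow> nat \<Rightarrow> 'a set" where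
  "color_class G c i = {v \<in> pverts G. c v = i}"

text \<open>
  All \<open>k\<close> colors have to be used. If empty color classes were allowed, a constant function would
  be a FAT \<open>k\<close>-coloring (with \<open>\<alpha> = 0\<close>) for every \<open>k \<ge> 1\<close>, and the FAT chromatic number would
  be undefined.
\<close>

definition vertex_coloring :: "'a pair_pre_digraph \<Rightarrow> nat \<Rightarrow> ('a \<Rightarrow> nat) \<Rightarrow> bool" where
  "vertex_coloring G k c \<longleftrightarrow> c ` pverts G = {1..k}"

definition fat_coloring :: "'a pair_pre_digraph \<Rightarrow> nat \<Rightarrow> ('a \<Rightarrow> nat) \<Rightarrow> bool" where
  "fat_coloring G k c \<longleftrightarrow>
     vertex_coloring G k c \<and>
     (\<exists>\<alpha>::real. 0 \<le> \<alpha> \<and> \<alpha> \<le> 1 \<and>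
       (let \<beta> = 1 - (real k - 1) * \<alpha> in
         \<forall>v\<in>pverts G. \<forall>i\<in>{1..k}.
           (v \<notin> color_class G c i \<longrightarrow>
              real (nbrs_in G v (color_class G c i)) = \<alpha> * real (out_degree (with_proj G) v)) \<and>
           (v \<in> color_class G c i \<longrightarrow>
              real (nbrs_in G v (color_class G c i)) = \<beta> * real (out_degree (with_proj G) v))))"

definition fat_chromatic_number :: "'a pair_pre_digraph \<Rightarrow> nat" where
  "fat_chromatic_number G = Max {k. \<exists>c. fat_coloring G k c}"

text \<open>The maximum is taken over a finite nonempty set of numbers of colors.\<close>

lemma fat_coloring_le_card:
  assumes "finite (pverts G)" "fat_coloring G k c"
  shows "k \<le> card (pverts G)"
  using card_image_le[OF assms(1), of c] assms(2)
  by (simp add: fat_coloring_def vertex_coloring_def)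

lemma finite_fat_color_numbers:
  "finite (pverts G) \<Longrightarrow> finite {k. \<exists>c. fat_coloring G k c}"
  by (rule finite_subset[of _ "{..card (pverts G)}"]) (auto dest: fat_coloring_le_card)

lemma fat_coloring_const:
  assumes "pair_graph G" "pverts G \<noteq> {}"
  shows "fat_coloring G 1 (\<lambda>_. 1)"
proof -
  interpret pair_graph G by fact
  have "nbrs_in G v (pverts G) = out_degree (with_proj G) v" for v
  proof -
    have "out_arcs (with_proj G) v = Pair v ` {u \<in> pverts G. (v, u) \<in> parcs G}"
      by (auto simp: out_arcs_def dest: in_arcsD2)
    thus ?thesis by (simp add: nbrs_in_def out_degree_def card_image inj_on_def)
  qed
  thus ?thesis using assms(2)
    by (auto simp: fat_coloring_def vertex_coloring_def color_class_def Let_def intro!: exI[of _ 0])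
qed

text \<open>
  For \<open>t = 1\<close> the graph \<open>T(N, t)\<close> has no edges, and every coloring is FAT. Hence FAT colorings
  need not be balanced or monochromatic in that case (for example, \<open>N = 3\<close> with colors \<open>1, 1, 2\<close>).
\<close>

lemma fat_coloring_one_part:
  assumes "regular_turan_graph G N 1 P" "vertex_coloring G k c"
  shows "fat_coloring G k c"
proof -
  have "parcs G = {}"
    using assms(1) by (auto simp: regular_turan_graph_def complete_partite_def)
  thus ?thesis using assms(2)
    by (auto simp: fat_coloring_def nbrs_in_def out_degree_def out_arcs_def intro!: exI[of _ 0])
qed

definition balanced_coloring :: "nat \<Rightarrow> (nat \<Rightarrow> 'a set) \<Rightarrow> nat \<Rightarrow> ('a \<Rightarrow> nat) \<Rightarrow> bool" where
  "balanced_coloring t P k c \<longleftrightarrow>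
     (\<forall>g\<in>{1..t}. {1..k} \<subseteq> c ` P g \<and> (\<exists>m. \<forall>i\<in>{1..k}. card {v \<in> P g. c v = i} = m))"

definition monochromatic_coloring :: "nat \<Rightarrow> (nat \<Rightarrow> 'a set) \<Rightarrow> nat \<Rightarrow> ('a \<Rightarrow> nat) \<Rightarrow> bool" where
  "monochromatic_coloring t P k c \<longleftrightarrow>
     (\<forall>g\<in>{1..t}. \<exists>!i. i \<in> c ` P g) \<and>
     (\<exists>m. \<forall>i\<in>{1..k}. card {g \<in> {1..t}. i \<in> c ` P g} = m)"

end

theory Submission
  imports Defs
begin

text \<open>
  A vertex of the part \<open>P g\<close> has exactly \<open>card (V i - P g)\<close> neighbours of color \<open>i\<close>, and this number
  depends on the vertex only through \<open>g\<close>. If \<open>\<alpha> = \<beta>\<close>, then \<open>card (V i - P g)\<close> is the same for all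
  \<open>g\<close> and \<open>i\<close>, which makes \<open>card (V i \<inter> P g)\<close> constant as well. If \<open>\<alpha> \<noteq> \<beta>\<close>, then a part with two
  colors would give the same number two different values, so every part is monochromatic, and
  the condition on \<open>\<beta>\<close> determines how many parts have a given color. The chromatic number is attained
  either by coloring each part bijectively or by giving each part its own color.
\<close>

section \<open>Neighbor counts in complete multipartite graphs\<close>

lemma nbrs_in_complete_partite:
  assumes "complete_partite G t P" "g \<in> {1..t}" "v \<in> P g" "S \<subseteq> pverts G"
  shows "nbrs_in G v S = card (S - P g)"
proof -
  have disj: "x = y" if "x \<in> {1..t}" "y \<in> {1..t}" "w \<in> P x" "w \<in> P y" for w x y
    using that assms(1) unfolding complete_partite_def disjoint_family_on_def
    by (meson disjoint_iff)
  have arcs: "(v, u) \<in> parcs G \<longleftrightarrow> (\<exists>x\<in>{1..t}. \<exists>y\<in>{1..t}. x \<noteq> y \<and> v \<in> P x \<and> u \<in> P y)" for u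
    using assms(1) by (simp add: complete_partite_def)
  have "(v, u) \<in> parcs G \<longleftrightarrow> u \<notin> P g" if "u \<in> S" for u
  proof -
    have "pverts G = (\<Union>x\<in>{1..t}. P x)" using assms(1) by (simp add: complete_partite_def)
    with that assms(4) obtain h where h: "h \<in> {1..t}" "u \<in> P h" by blast
    show ?thesis
    proof
      assume "(v, u) \<in> parcs G"
      then obtain x y where xy: "x \<in> {1..t}" "y \<in> {1..t}" "x \<noteq> y" "v \<in> P x" "u \<in> P y"
        unfolding arcs by blast
      have "x = g" using disj xy(1,4) assms(2,3) by blast
      thus "u \<notin> P g" using disj[OF xy(2) assms(2) xy(5)] xy(3) by blast
    next
      assume "u \<notin> P g"
      hence "g \<noteq> h" using h(2) by blast
      thus "(v, u) \<in> parcs G" unfolding arcs using assms(2,3) h by blast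
    qed
  qed
  hence "{u \<in> S. (v, u) \<in> parcs G} = S - P g" by blast
  thus ?thesis by (simp only: nbrs_in_def)
qed

lemma out_degree_eq_nbrs_in:
  assumes "pair_graph G"
  shows "out_degree (with_proj G) v = nbrs_in G v (pverts G)"
proof -
  interpret pair_graph G by fact
  have "out_arcs (with_proj G) v = Pair v ` {u \<in> pverts G. (v, u) \<in> parcs G}"
    by (auto simp: out_arcs_def dest: in_arcsD2)
  thus ?thesis by (simp add: nbrs_in_def out_degree_def card_image inj_on_def)
qed

section \<open>Part sizes, degrees and color counts in the regular Turan graph\<close>

locale turan =
  fixes G :: "'a pair_pre_digraph" and N t :: nat and P :: "nat \<Rightarrow> 'a set"
  assumes N: "N \<ge> 1" and t: "t \<ge> 1" and dvd: "t dvd N"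
    and turan: "regular_turan_graph G N t P"
begin

definition m :: nat where "m = N div t"

lemma partite: "complete_partite G t P"
  using turan by (simp add: regular_turan_graph_def)

lemma disjoint: "disjoint_family_on P {1..t}"
  and pverts_eq: "pverts G = (\<Union>g\<in>{1..t}. P g)"
  using partite by (auto simp: complete_partite_def)

lemma card_part: "g \<in> {1..t} \<Longrightarrow> card (P g) = m"
  using turan by (simp add: regular_turan_graph_def m_def)

lemma N_eq: "N = t * m"
  using dvd by (simp add: m_def)

lemma m_pos: "m \<ge> 1"
  using N N_eq by (cases m) auto

lemma finite_pverts: "finite (pverts G)"
proof -
  have "pair_graph G" using partite by (simp add: complete_partite_def)
  then interpret pair_graph G .
  show ?thesis by simp
qed

lemma finite_part: "g \<in> {1..t} \<Longrightarrow> finite (P g)"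
  using finite_pverts pverts_eq by (auto intro: finite_subset)

lemma part_nonempty: "g \<in> {1..t} \<Longrightarrow> P g \<noteq> {}"
  using partite by (auto simp: complete_partite_def)

lemma part_unique: "\<lbrakk>v \<in> P g; v \<in> P h; g \<in> {1..t}; h \<in> {1..t}\<rbrakk> \<Longrightarrow> g = h"
  using disjoint unfolding disjoint_family_on_def by (meson disjoint_iff)

lemma degree:
  assumes "g \<in> {1..t}" "v \<in> P g"
  shows "real (out_degree (with_proj G) v) = (real t - 1) * real m"
proof -
  have "out_degree (with_proj G) v = card (pverts G - P g)"
    using out_degree_eq_nbrs_in[of G v] nbrs_in_complete_partite[OF partite assms] partite
    by (simp add: complete_partite_def)
  also have "\<dots> = t * m - m"
    using assms turan card_part[OF assms(1)] finite_part[OF assms(1)] pverts_eq N_eq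
    by (subst card_Diff_subset) (auto simp: regular_turan_graph_def)
  finally show ?thesis using t m_pos by (simp add: of_nat_diff algebra_simps)
qed

lemma color_class_split: "color_class G c i = (\<Union>g\<in>{1..t}. {v \<in> P g. c v = i})"
  by (auto simp: color_class_def pverts_eq)

lemma card_color_class:
  "card (color_class G c i) = (\<Sum>g\<in>{1..t}. card {v \<in> P g. c v = i})"
  unfolding color_class_split
  by (rule card_UN_disjoint) (auto simp: finite_part dest: part_unique)

lemma card_color_class_outside:
  assumes "g \<in> {1..t}"
  shows "card (color_class G c i - P g) = (\<Sum>h\<in>{1..t} - {g}. card {v \<in> P h. c v = i})"
proof -
  have "color_class G c i - P g = (\<Union>h\<in>{1..t} - {g}. {v \<in> P h. c v = i})"
    using assms part_unique by (auto simp: color_class_split)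
  thus ?thesis by (simp only:) (rule card_UN_disjoint; auto simp: finite_part dest: part_unique)
qed

text \<open>Neighbor counts and the common degree are replaced by the numbers of vertices of each
  color in each part. The arguments below use this form, which no longer mentions edges.\<close>

lemma fat_coloring_iff:
  "fat_coloring G k c \<longleftrightarrow> c ` pverts G = {1..k} \<and>
    (\<exists>\<alpha>::real. 0 \<le> \<alpha> \<and> \<alpha> \<le> 1 \<and> (\<forall>g\<in>{1..t}. \<forall>v\<in>P g. \<forall>i\<in>{1..k}.
      (\<Sum>h\<in>{1..t} - {g}. real (card {u \<in> P h. c u = i}))
        = (if c v = i then 1 - (real k - 1) * \<alpha> else \<alpha>) * ((real t - 1) * real m)))"
proof -
  have *: "real (nbrs_in G v (color_class G c i)) = (\<Sum>h\<in>{1..t} - {g}. real (card {u \<in> P h. c u = i}))"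
    if "g \<in> {1..t}" "v \<in> P g" for g v i
  proof -
    have "color_class G c i \<subseteq> pverts G" by (auto simp: color_class_def)
    from nbrs_in_complete_partite[OF partite that this] show ?thesis
      by (simp only: card_color_class_outside[OF that(1)] of_nat_sum)
  qed
  have **: "v \<in> color_class G c i \<longleftrightarrow> c v = i" if "g \<in> {1..t}" "v \<in> P g" for g v i
    using that pverts_eq by (auto simp: color_class_def)
  show ?thesis
    unfolding fat_coloring_def vertex_coloring_def Let_def pverts_eq ball_UN
  proof (intro conj_cong refl ex_cong1 ball_cong)
    fix \<alpha> :: real and g v i assume gv: "g \<in> {1..t}" "v \<in> P g"
    let ?e = "real (nbrs_in G v (color_class G c i))"
    let ?d = "real (out_degree (with_proj G) v)"
    show "((v \<notin> color_class G c i \<longrightarrow> ?e = \<alpha> * ?d) \<and>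
        (v \<in> color_class G c i \<longrightarrow> ?e = (1 - (real k - 1) * \<alpha>) * ?d)) \<longleftrightarrow>
      (\<Sum>h\<in>{1..t} - {g}. real (card {u \<in> P h. c u = i}))
        = (if c v = i then 1 - (real k - 1) * \<alpha> else \<alpha>) * ((real t - 1) * real m)"
      unfolding *[OF gv] **[OF gv] degree[OF gv] by simp
  qed
qed

section \<open>The dichotomy for at least two parts\<close>

lemma balanced_or_monochromatic:
  assumes "t \<ge> 2" "fat_coloring G k c"
  shows "balanced_coloring t P k c \<or> monochromatic_coloring t P k c"
proof -
  define a where "a g i = card {u \<in> P g. c u = i}" for g i
  define n where "n i = (\<Sum>g\<in>{1..t}. a g i)" for i
  \<comment> \<open>The common degree of all vertices. It is positive because
    \<open>t \<ge> 2\<close>, so it can be cancelled later.\<close>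
  define D where "D = (real t - 1) * real m"
  have D: "D > 0" using assms(1) m_pos by (simp add: D_def)
  obtain \<alpha> where surj: "c ` pverts G = {1..k}"
    and fat: "\<And>g v i. \<lbrakk>g \<in> {1..t}; v \<in> P g; i \<in> {1..k}\<rbrakk> \<Longrightarrow>
      (\<Sum>h\<in>{1..t} - {g}. real (a h i)) = (if c v = i then 1 - (real k - 1) * \<alpha> else \<alpha>) * D"
    using assms(2) unfolding fat_coloring_iff a_def D_def by blast
  define \<beta> where "\<beta> = 1 - (real k - 1) * \<alpha>"
  have count: "real (n i) - real (a g i) = (if c v = i then \<beta> else \<alpha>) * D"
    if "g \<in> {1..t}" "v \<in> P g" "i \<in> {1..k}" for g v i
    using fat[OF that] that(1) by (simp add: n_def \<beta>_def sum_diff1)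
  have color: "c v \<in> {1..k}" if "g \<in> {1..t}" "v \<in> P g" for g v
    using that unfolding surj[symmetric] pverts_eq by blast
  have occurs: "\<exists>g\<in>{1..t}. \<exists>v\<in>P g. c v = i" if "i \<in> {1..k}" for i
    using that unfolding surj[symmetric] pverts_eq by auto
  show ?thesis
  proof (cases "\<alpha> = \<beta>")
    case True
    \<comment> \<open>Every part contributes \<open>n i - \<alpha> * D\<close> vertices of color
      \<open>i\<close>. Summing over the parts gives \<open>n i = t * (n i - \<alpha> * D)\<close>,
      which eliminates \<open>n i\<close> and leaves a value free of both \<open>g\<close> and
      \<open>i\<close>.\<close>
    have a_eq: "real (a g i) = \<alpha> * D / (real t - 1)" if "g \<in> {1..t}" "i \<in> {1..k}" for g i
    proof -
      have *: "real (a h i) = real (n i) - \<alpha> * D" if h: "h \<in> {1..t}" for h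
      proof -
        obtain v where "v \<in> P h" using part_nonempty[OF h] by blast
        from count[OF h this \<open>i \<in> {1..k}\<close>] show ?thesis using True by (cases "c v = i") simp_all
      qed
      have "real (n i) = (\<Sum>h\<in>{1..t}. real (a h i))" by (simp add: n_def)
      also have "\<dots> = (\<Sum>h\<in>{1..t}. real (n i) - \<alpha> * D)" by (intro sum.cong refl *)
      finally have "(real t - 1) * real (a g i) = \<alpha> * D"
        unfolding *[OF that(1)] by (simp add: algebra_simps)
      thus ?thesis using assms(1) by (simp add: eq_divide_eq mult.commute)
    qed
    have const: "a g i = a h j" if "g \<in> {1..t}" "h \<in> {1..t}" "i \<in> {1..k}" "j \<in> {1..k}" for g h i j
      using a_eq[OF that(1,3)] a_eq[OF that(2,4)] by simp
    have "i \<in> c ` P g" if g: "g \<in> {1..t}" and i: "i \<in> {1..k}" for g i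
    proof -
      \<comment> \<open>Color \<open>i\<close> is used in some part, so the common count is positive
        and the color occurs in every part.\<close>
      obtain h v where h: "h \<in> {1..t}" "v \<in> P h" "c v = i" using occurs[OF i] by blast
      hence "a h i > 0" using finite_part by (auto simp: a_def card_gt_0_iff)
      hence "a g i > 0" using const[OF g h(1) i i] by simp
      thus ?thesis by (auto simp: a_def card_gt_0_iff)
    qed
    moreover have "\<exists>q. \<forall>i\<in>{1..k}. a g i = q" if "g \<in> {1..t}" for g
    proof (intro exI ballI)
      fix i assume "i \<in> {1..k}"
      thus "a g i = a g 1" using that by (intro const) auto
    qed
    ultimately show ?thesis unfolding balanced_coloring_def a_def by blast
  next
    case False
    have mono: "c u = c v" if "g \<in> {1..t}" "u \<in> P g" "v \<in> P g" for g u v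
    proof (rule ccontr)
      assume "c u \<noteq> c v"
      \<comment> \<open>Color \<open>c v\<close> is counted twice from the same part: from
        \<open>u\<close>, where it is a foreign color, and from \<open>v\<close>, where it is the
        vertex's own.\<close>
      hence "\<alpha> * D = real (n (c v)) - real (a g (c v))"
        using count[OF that(1,2) color[OF that(1,3)]] by simp
      also have "\<dots> = \<beta> * D" using count[OF that(1,3) color[OF that(1,3)]] by simp
      finally have "\<alpha> * D = \<beta> * D" .
      with False D show False by simp
    qed
    have a_eq: "a g i = (if i \<in> c ` P g then m else 0)" if g: "g \<in> {1..t}" for g i
    proof (cases "i \<in> c ` P g")
      case True
      hence "{u \<in> P g. c u = i} = P g" using mono[OF g] by blast
      thus ?thesis using True card_part[OF g] by (simp add: a_def)
    next
      case False
      hence "{u \<in> P g. c u = i} = {}" by auto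
      thus ?thesis using False unfolding a_def by (simp only: card.empty if_False)
    qed
    have n_eq: "n i = m * card {g \<in> {1..t}. i \<in> c ` P g}" for i
    proof -
      have "n i = (\<Sum>g\<in>{1..t}. if i \<in> c ` P g then m else 0)"
        unfolding n_def by (rule sum.cong[OF refl a_eq])
      also have "\<dots> = (\<Sum>g\<in>{g \<in> {1..t}. i \<in> c ` P g}. m)"
        by (rule sum.inter_filter[symmetric]) simp
      finally show ?thesis by simp
    qed
    \<comment> \<open>A part with color \<open>i\<close> consists of \<open>m\<close> vertices of
      that color, so the own-color condition reads \<open>n i - m = \<beta> * (t - 1) * m\<close>.
      Dividing by \<open>m\<close> counts the parts, with a result independent of
      \<open>i\<close>.\<close>
    have parts: "real (card {g \<in> {1..t}. i \<in> c ` P g}) = 1 + \<beta> * (real t - 1)" if i: "i \<in> {1..k}" for i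
    proof -
      obtain g v where g: "g \<in> {1..t}" "v \<in> P g" "c v = i" using occurs[OF i] by blast
      hence "a g i = m" using a_eq[OF g(1), of i] by auto
      hence "real (n i) - real m = \<beta> * D"
        using count[OF g(1,2) i] g(3) by simp
      hence "real m * real (card {g \<in> {1..t}. i \<in> c ` P g}) = real m * (1 + \<beta> * (real t - 1))"
        unfolding n_eq by (simp add: D_def algebra_simps)
      thus ?thesis using m_pos by (simp only: mult_cancel_left) simp
    qed
    have "\<exists>q. \<forall>i\<in>{1..k}. card {g \<in> {1..t}. i \<in> c ` P g} = q"
    proof (intro exI ballI)
      fix i assume i: "i \<in> {1..k}"
      hence "1 \<in> {1..k}" by simp
      from parts[OF i] parts[OF this]
      show "card {g \<in> {1..t}. i \<in> c ` P g} = card {g \<in> {1..t}. 1 \<in> c ` P g}"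
        by (simp only: of_nat_eq_iff[where 'a = real, symmetric])
    qed
    moreover have "\<exists>!i. i \<in> c ` P g" if g: "g \<in> {1..t}" for g
    proof -
      obtain v where "v \<in> P g" using part_nonempty[OF g] by blast
      hence "c ` P g = {c v}" using mono[OF g] by blast
      thus ?thesis by simp
    qed
    ultimately show ?thesis unfolding monochromatic_coloring_def by blast
  qed
qed

section \<open>Bounds and constructions for the FAT chromatic number\<close>

text \<open>In the balanced case a single part shows all colors, so \<open>k \<le> m\<close>; in the
  monochromatic case the parts map onto the colors, so \<open>k \<le> t\<close>. For
  \<open>t = 1\<close> the bound is the number of vertices, which is \<open>m\<close>.\<close>

lemma fat_coloring_le_max:
  assumes "fat_coloring G k c"
  shows "k \<le> max t m"
proof (cases "t \<ge> 2")
  case True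
  have surj: "c ` pverts G = {1..k}" using assms by (simp add: fat_coloring_iff)
  from balanced_or_monochromatic[OF True assms] show ?thesis
  proof
    assume "balanced_coloring t P k c"
    hence "{1..k} \<subseteq> c ` P 1" using t by (auto simp: balanced_coloring_def)
    hence "k \<le> card (P 1)"
      using surj_card_le[of "P 1" "{1..k}" c] finite_part[of 1] t by simp
    thus ?thesis using card_part[of 1] t by simp
  next
    assume "monochromatic_coloring t P k c"
    hence *: "\<exists>!i. i \<in> c ` P g" if "g \<in> {1..t}" for g
      using that by (simp add: monochromatic_coloring_def)
    have "{1..k} \<subseteq> (\<lambda>g. THE i. i \<in> c ` P g) ` {1..t}"
    proof
      fix i assume "i \<in> {1..k}"
      then obtain g where g: "g \<in> {1..t}" "i \<in> c ` P g"
        unfolding surj[symmetric] pverts_eq by blast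
      hence "(THE i. i \<in> c ` P g) = i" using *[OF g(1)] by (intro the1_equality)
      thus "i \<in> (\<lambda>g. THE i. i \<in> c ` P g) ` {1..t}" using g(1) by force
    qed
    thus ?thesis using surj_card_le[OF finite_atLeastAtMost] by fastforce
  qed
next
  case False
  hence "N = m" using N_eq t by (cases "t = 1") auto
  thus ?thesis
    using fat_coloring_le_card[OF finite_pverts assms] turan by (simp add: regular_turan_graph_def)
qed

text \<open>If each part contains each of \<open>m\<close> colors once, every vertex sees each
  color, its own included, exactly \<open>t - 1\<close> times. Hence \<alpha> and \<beta> both equal
  \<open>1 / m\<close>.\<close>

lemma ex_fat_coloring_rainbow_parts: "\<exists>c. fat_coloring G m c"
proof -
  have "\<exists>f. bij_betw f (P g) {1..m}" if "g \<in> {1..t}" for g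
    using that finite_part card_part by (auto intro: finite_same_card_bij)
  then obtain f where f: "\<And>g. g \<in> {1..t} \<Longrightarrow> bij_betw (f g) (P g) {1..m}" by metis
  \<comment> \<open>The bijections chosen on the parts are glued along the unique part containing
    \<open>v\<close>.\<close>
  define c where "c v = f (THE g. g \<in> {1..t} \<and> v \<in> P g) v" for v
  have c: "c v = f g v" if "g \<in> {1..t}" "v \<in> P g" for g v
  proof -
    have "(THE g. g \<in> {1..t} \<and> v \<in> P g) = g" using that part_unique by blast
    thus ?thesis by (simp add: c_def)
  qed
  have bij: "bij_betw c (P g) {1..m}" if "g \<in> {1..t}" for g
    using f[OF that] c[OF that] by (simp cong: bij_betw_cong)
  have surj: "c ` pverts G = {1..m}"
    using bij t unfolding pverts_eq image_UN by (auto simp: bij_betw_def)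
  have one: "card {u \<in> P h. c u = i} = 1" if h: "h \<in> {1..t}" and i: "i \<in> {1..m}" for h i
  proof -
    have "i \<in> c ` P h" using bij[OF h] i by (simp add: bij_betw_def)
    then obtain u where "u \<in> P h" "c u = i" by blast
    hence "{u \<in> P h. c u = i} = {u}" using bij[OF h] by (auto simp: bij_betw_def inj_on_def)
    thus ?thesis by simp
  qed
  have "fat_coloring G m c"
    unfolding fat_coloring_iff
  proof (intro conjI surj exI[of _ "1 / real m"] ballI)
    fix g v i assume "g \<in> {1..t}" "v \<in> P g" "i \<in> {1..m}"
    moreover from this have "(\<Sum>h\<in>{1..t} - {g}. real (card {u \<in> P h. c u = i})) = real t - 1"
      using t by (simp add: one of_nat_diff)
    ultimately show "(\<Sum>h\<in>{1..t} - {g}. real (card {u \<in> P h. c u = i}))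
      = (if c v = i then 1 - (real m - 1) * (1 / real m) else 1 / real m) * ((real t - 1) * real m)"
      using m_pos by (simp add: field_simps)
  qed (use m_pos in auto)
  thus ?thesis by blast
qed

text \<open>Coloring each vertex by the index of its part is proper: for \<open>t \<ge> 2\<close>,
  \<beta> is 0 and the degree is shared equally among the other \<open>t - 1\<close> colors.\<close>

lemma ex_fat_coloring_parts: "\<exists>c. fat_coloring G t c"
proof -
  define c where "c v = (THE g. g \<in> {1..t} \<and> v \<in> P g)" for v
  have c: "c v = g" if "g \<in> {1..t}" "v \<in> P g" for g v
    using that part_unique unfolding c_def by blast
  have surj: "c ` pverts G = {1..t}"
  proof -
    have "c ` P g = {g}" if "g \<in> {1..t}" for g
      using part_nonempty[OF that] c[OF that] by (auto simp: image_iff)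
    thus ?thesis unfolding pverts_eq image_UN by auto
  qed
  have eq: "card {u \<in> P h. c u = i} = (if h = i then m else 0)" if "h \<in> {1..t}" for h i
  proof -
    have *: "{u \<in> P h. c u = i} = (if h = i then P h else {})" using c[OF that] by auto
    show ?thesis unfolding * using card_part[OF that] by auto
  qed
  have "fat_coloring G t c"
    unfolding fat_coloring_iff
  \<comment> \<open>For \<open>t = 1\<close> division by zero makes this witness 0, still in the
    unit interval; both sides of the condition then vanish because the degree is 0.\<close>
  proof (intro conjI surj exI[of _ "1 / (real t - 1)"] ballI)
    fix g v i assume *: "g \<in> {1..t}" "v \<in> P g" "i \<in> {1..t}"
    have "(\<Sum>h\<in>{1..t} - {g}. real (card {u \<in> P h. c u = i})) =
        (\<Sum>h\<in>{1..t} - {g}. if h = i then real m else 0)"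
      by (intro sum.cong refl) (simp add: eq)
    also have "\<dots> = (if g = i then 0 else real m)" using * by (simp add: sum.delta)
    finally show "(\<Sum>h\<in>{1..t} - {g}. real (card {u \<in> P h. c u = i}))
      = (if c v = i then 1 - (real t - 1) * (1 / (real t - 1)) else 1 / (real t - 1))
          * ((real t - 1) * real m)"
      using * c[OF *(1,2)] by (cases "t = 1") auto
  qed (use t in \<open>auto simp: divide_simps\<close>)
  thus ?thesis by blast
qed

lemma fat_chromatic_number_eq: "fat_chromatic_number G = max t m"
  unfolding fat_chromatic_number_def
proof (rule Max_eqI)
  show "finite {k. \<exists>c. fat_coloring G k c}" using finite_pverts by (rule finite_fat_color_numbers)
  show "k \<le> max t m" if "k \<in> {k. \<exists>c. fat_coloring G k c}" for k
    using that fat_coloring_le_max by blast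
  show "max t m \<in> {k. \<exists>c. fat_coloring G k c}"
    using ex_fat_coloring_rainbow_parts ex_fat_coloring_parts by (simp add: max_def)
qed

end

text \<open>The dichotomy is restricted to \<open>t \<ge> 2\<close> because every coloring of the
  edgeless graph at \<open>t = 1\<close> is FAT. The formula for the chromatic number covers
  \<open>t = 1\<close> too, with value \<open>N\<close>.\<close>

theorem theorem4p4:
  fixes G :: "'a pair_pre_digraph" and P :: "nat \<Rightarrow> 'a set" and N t :: nat
  assumes "N \<ge> 1" and "t \<ge> 1" and "t dvd N"
    and "regular_turan_graph G N t P"
  shows "(t \<ge> 2 \<longrightarrow> (\<forall>k c. fat_coloring G k c \<longrightarrow>
            balanced_coloring t P k c \<or> monochromatic_coloring t P k c)) \<and>
         fat_chromatic_number G = max t (N div t)"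
proof -
  interpret turan G N t P using assms by unfold_locales
  show ?thesis
    using balanced_or_monochromatic fat_chromatic_number_eq unfolding m_def by blast
qed

end
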